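(* Let $(c_\nu)_{\nu\in\mathcal{F}}$ and $(\omega_\nu)_{\nu\in\mathcal{F}}$ be sequences of positive numbers such that $$\sum_{\nu\in\mathcal{F}}(\omega_\nu c_\nu)^2<\infty,$$ and such that $(\kappa_\nu)_{\nu\in\mathcal{F}}\in \ell^q_m(\mathcal{F})$ for some $0<q<\infty$, where $\kappa_\nu:=\omega_\nu^{-1}$. Then, for any $0<r\leq 2$ such that $\frac1q>\frac1r-\frac12$, there exist a constant $C$ (independent of $n$) and a nested sequence $\Lambda_1\subset\Lambda_2\subset\cdots$ of downward closed subsets of $\mathcal{F}$ such that, for all $n\ge 1$, $\#(\Lambda_n)=n$ and $$\left(\sum_{\nu\notin\Lambda_n}c_\nu^r\right)^{1/r}\leq C n^{-s},\qquad s:=\frac1q+\frac12-\frac1r>0.$$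
   Context: $\mathcal{F}$ denotes either $\mathbb{N}_0^d$ (for some $d\in\mathbb{N}$) or, in the case $d=\infty$, the set of finitely supported sequences $\nu=(\nu_j)_{j\ge1}$ of nonnegative integers. It is partially ordered by: $\widetilde\nu\le\nu$ iff $\widetilde\nu_j\le\nu_j$ for all $j$. A set $\Lambda\subset\mathcal{F}$ is downward closed if $\nu\in\Lambda$ and $\widetilde\nu\le\nu$ imply $\widetilde\nu\in\Lambda$. The monotone majorant of a bounded sequence $(\kappa_\nu)_{\nu\in\mathcal{F}}$ is $\widehat\kappa_\nu:=\sup_{\widetilde\nu\ge\nu}|\kappa_{\widetilde\nu}|$ (the supremum is a maximum when $\#\{\nu:|\kappa_\nu|>\delta\}<\infty$ for all $\delta>0$). For $0<q<\infty$, a bounded sequence $(\kappa_\nu)_{\nu\in\mathcal{F}}$ belongs to $\ell^q_m(\mathcal{F})$ if and only if $(\widehat\kappa_\nu)_{\nu\in\mathcal{F}}\in\ell^q(\mathcal{F})$. *)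

theory Defs
  imports "HOL-Analysis.Analysis" "HOL-Library.Extended_Nat"
begin

text \<open>
  Multi-indices of length \<open>d\<close>, where \<open>d\<close> is a natural number or \<open>\<infinity>\<close>. Coordinates are numbered
  from 0, and a tuple of finite length \<open>d\<close> is extended by zeros; hence the
  library's pointwise order on functions is the coordinatewise order on multi-indices.
\<close>

definition multi_indices :: "enat \<Rightarrow> (nat \<Rightarrow> nat) set" where
  "multi_indices d = {\<nu>. finite {j. \<nu> j \<noteq> 0} \<and> (\<forall>j. enat j \<ge> d \<longrightarrow> \<nu> j = 0)}"

definition downward_closed :: "'a::order set \<Rightarrow> 'a set \<Rightarrow> bool" where
  "downward_closed F \<Lambda> \<longleftrightarrow> \<Lambda> \<subseteq> F \<and> (\<forall>\<nu>\<in>\<Lambda>. \<forall>\<nu>'\<in>F. \<nu>' \<le> \<nu> \<longrightarrow> \<nu>' \<in> \<Lambda>)"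

definition monotone_majorant :: "'a::order set \<Rightarrow> ('a \<Rightarrow> real) \<Rightarrow> 'a \<Rightarrow> real" where
  "monotone_majorant F \<kappa> \<nu> = (SUP \<nu>'\<in>{\<nu>'\<in>F. \<nu> \<le> \<nu>'}. \<bar>\<kappa> \<nu>'\<bar>)"

definition ell :: "real \<Rightarrow> 'a set \<Rightarrow> ('a \<Rightarrow> real) set" where
  "ell q F = {x. (\<lambda>\<nu>. \<bar>x \<nu>\<bar> powr q) summable_on F}"

definition ell_m :: "real \<Rightarrow> 'a::order set \<Rightarrow> ('a \<Rightarrow> real) set" where
  "ell_m q F = {\<kappa>. bounded (\<kappa> ` F) \<and> monotone_majorant F \<kappa> \<in> ell q F}"

end

theory Submission
  imports Defs
begin

text \<open>
  Let \<open>g\<close> be the monotone majorant of \<open>\<kappa>\<close> and \<open>G\<close> the sum of \<open>g\<^sup>q\<close>. Collecting the indices in the order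
  of decreasing \<open>g\<close> gives the sets \<open>\<Lambda>\<^sub>n\<close>: since \<open>g\<close> is antitone, ties can be broken so that every
  initial segment is downward closed (\<open>greedy_downward_closed_sets\<close>). An index \<open>\<nu>\<close> outside \<open>\<Lambda>\<^sub>n\<close> has
  \<open>g \<nu>\<close> below the \<open>n\<close> values collected so far, so that \<open>n (g \<nu>)\<^sup>q \<le> G\<close>; this is the only place where
  the number \<open>n\<close> enters the estimate.

  The tail sum is then bounded term by term. With \<open>x = (\<omega> c)\<^sup>2\<close> one has \<open>c\<^sup>r = x\<^bsup>r/2\<^esup> \<kappa>\<^sup>r\<close>, and
  \<open>r = q (1 - r/2) + q r s\<close> splits the second factor: the part \<open>g\<^bsup>q r s\<^esup>\<close> is at most \<open>(G/n)\<^bsup>r s\<^esup>\<close>,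
  while the remaining weighted geometric mean of \<open>x\<close> and \<open>g\<^sup>q\<close> is at most \<open>x + g\<^sup>q\<close>, which is summable.
  Hence the tail of \<open>c\<^sup>r\<close> is at most \<open>(G/n)\<^bsup>r s\<^esup> (X + G)\<close>, where \<open>X\<close> is the sum of \<open>x\<close>, and the root of
  order \<open>r\<close> gives the rate \<open>n\<^bsup>-s\<^esup>\<close>. Bounding the mean by the sum takes the place of Hoelder's inequality
  and treats \<open>r = 2\<close> together with \<open>r < 2\<close>.
\<close>

section \<open>Index sets ordered by decreasing majorant\<close>

lemma infinite_multi_indices:
  assumes "d \<ge> 1"
  shows "infinite (multi_indices d)"
proof -
  let ?e = "\<lambda>(k::nat) (j::nat). if j = 0 then k else 0"
  have "inj ?e"
    by (rule injI) (metis (full_types))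
  moreover have "range ?e \<subseteq> multi_indices d"
  proof -
    have "finite {j. ?e k j \<noteq> 0}" for k
      by (rule finite_subset[of _ "{0}"]) auto
    moreover have "\<not> enat 0 \<ge> d"
      using assms by (metis enat_0 not_one_le_zero order_trans)
    ultimately show ?thesis
      unfolding multi_indices_def by auto
  qed
  ultimately show ?thesis
    using finite_subset finite_imageD infinite_UNIV_nat by metis
qed

lemma finite_superlevel_set_if_summable_powr:
  fixes g :: "'a \<Rightarrow> real"
  assumes sm: "(\<lambda>x. g x powr q) summable_on F"
    and "q > 0" "\<delta> > 0"
  shows "finite {x \<in> F. g x \<ge> \<delta>}"
proof (rule ccontr)
  let ?S = "{x \<in> F. g x \<ge> \<delta>}"
  let ?G = "\<Sum>\<^sub>\<infinity>x\<in>F. g x powr q"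
  assume "infinite ?S"
  obtain N :: nat where N: "?G < real N * \<delta> powr q"
    using reals_Archimedean3[of "\<delta> powr q"] \<open>\<delta> > 0\<close> by auto
  obtain A where A: "A \<subseteq> ?S" "finite A" "card A = N"
    using infinite_arbitrarily_large[OF \<open>infinite ?S\<close>] by blast
  have "real N * \<delta> powr q = (\<Sum>x\<in>A. \<delta> powr q)"
    using A by simp
  also have "\<dots> \<le> (\<Sum>x\<in>A. g x powr q)"
    using A \<open>q > 0\<close> \<open>\<delta> > 0\<close> by (intro sum_mono powr_mono2) auto
  also have "\<dots> \<le> ?G"
    using A by (intro finite_sum_le_infsum sm) auto
  finally show False
    using N by simp
qed

text \<open>
  The next index is taken among the maximizers of \<open>g\<close> outside \<open>\<Lambda>\<close>, and minimal among these for the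
  partial order. Anything strictly below it has a value of \<open>g\<close> at least as large, so by minimality it
  was collected before; this keeps the sets downward closed.
\<close>

lemma greedy_downward_closed_sets:
  fixes F :: "'a::order set" and g :: "'a \<Rightarrow> real"
  assumes inf: "infinite F" and pos: "\<And>x. x \<in> F \<Longrightarrow> g x > 0"
    and anti: "\<And>x y. x \<in> F \<Longrightarrow> y \<in> F \<Longrightarrow> x \<le> y \<Longrightarrow> g y \<le> g x"
    and fin: "\<And>\<delta>. \<delta> > 0 \<Longrightarrow> finite {x \<in> F. g x \<ge> \<delta>}"
  obtains \<Lambda> :: "nat \<Rightarrow> 'a set" where
    "\<And>n. finite (\<Lambda> n)" "\<And>n. card (\<Lambda> n) = n" "\<And>n. \<Lambda> n \<subseteq> \<Lambda> (Suc n)"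
    "\<And>n. downward_closed F (\<Lambda> n)"
    "\<And>n x y. x \<in> \<Lambda> n \<Longrightarrow> y \<in> F - \<Lambda> n \<Longrightarrow> g y \<le> g x"
proof -
  define P where "P n L \<longleftrightarrow> finite L \<and> card L = n \<and> downward_closed F L
      \<and> (\<forall>x\<in>L. \<forall>y\<in>F - L. g y \<le> g x)" for n :: nat and L
  have step: "\<exists>L'. P (Suc n) L' \<and> L \<subseteq> L'" if "P n L" for n L
  proof -
    have L: "finite L" "card L = n" "downward_closed F L"
      and Lg: "\<And>x y. x \<in> L \<Longrightarrow> y \<in> F - L \<Longrightarrow> g y \<le> g x"
      using that by (auto simp: P_def)
    obtain z where z: "z \<in> F - L"
      using inf L(1) by (metis Diff_infinite_finite ex_in_conv finite.emptyI)
    define S where "S = {x \<in> F - L. g x \<ge> g z}"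
    have "finite S"
      by (rule finite_subset[OF _ fin[of "g z"]]) (use z pos in \<open>auto simp: S_def\<close>)
    moreover have "z \<in> S"
      using z by (simp add: S_def)
    ultimately have "Max (g ` S) \<in> g ` S"
      by (intro Max_in) auto
    then obtain m where "m \<in> S" "g m = Max (g ` S)"
      by auto
    then have m: "m \<in> S" "\<And>y. y \<in> S \<Longrightarrow> g y \<le> g m"
      using \<open>finite S\<close> by auto
    have m_max: "g y \<le> g m" if "y \<in> F - L" for y
      using m that unfolding S_def by (cases "g y \<ge> g z") auto
    define M where "M = {x \<in> S. g x = g m}"
    have "finite M" "M \<noteq> {}"
      using \<open>finite S\<close> m by (auto simp: M_def)
    then obtain w where w: "w \<in> M" and w_min: "\<And>y. y \<in> M \<Longrightarrow> y \<le> w \<Longrightarrow> w = y"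
      using finite_has_minimal[of M] by blast
    have wF: "w \<in> F - L" and gw: "g w = g m"
      using w by (auto simp: M_def S_def)
    have below: "y \<in> insert w L" if "y \<in> F" "y \<le> w" for y
    proof (rule ccontr)
      assume y: "y \<notin> insert w L"
      have "g y = g m"
        using anti[of y w] m_max[of y] y that wF gw by auto
      then have "y \<in> M"
        using y that m(1) by (auto simp: M_def S_def)
      then show False
        using w_min that y by blast
    qed
    have "downward_closed F (insert w L)"
      using L(3) wF below unfolding downward_closed_def by blast
    moreover have "\<forall>x\<in>insert w L. \<forall>y\<in>F - insert w L. g y \<le> g x"
      using Lg m_max gw by auto
    ultimately have "P (Suc n) (insert w L)"
      using L wF by (simp add: P_def)
    then show ?thesis
      by blast
  qed
  have "P 0 {}"
    by (simp add: P_def downward_closed_def)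
  then obtain \<Lambda> where \<Lambda>: "\<And>n. P n (\<Lambda> n) \<and> \<Lambda> n \<subseteq> \<Lambda> (Suc n)"
    using dependent_nat_choice[of P "\<lambda>_ L L'. L \<subseteq> L'"] step by metis
  show thesis
    by (rule that[of \<Lambda>]) (use \<Lambda> in \<open>auto simp: P_def\<close>)
qed

section \<open>Estimates for the tail sum\<close>

text \<open>
  This is why a decreasing rearrangement of a summable family decays like \<open>1/n\<close>: take for \<open>A\<close> the
  \<open>n\<close> largest terms and for \<open>y\<close> any other index.
\<close>

lemma card_mult_le_infsum:
  fixes f :: "'a \<Rightarrow> real"
  assumes "f summable_on F" "\<And>x. x \<in> F \<Longrightarrow> f x \<ge> 0"
    and "finite A" "A \<subseteq> F" "\<And>x. x \<in> A \<Longrightarrow> f y \<le> f x"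
  shows "real (card A) * f y \<le> infsum f F"
proof -
  have "real (card A) * f y \<le> sum f A"
    using sum_bounded_below[of A "f y" f] assms(5) by simp
  also have "\<dots> \<le> infsum f F"
    using assms by (intro finite_sum_le_infsum) auto
  finally show ?thesis .
qed

text \<open>
  Both factors only grow when \<open>x\<close> and \<open>y\<close> are replaced by \<open>x + y\<close>, and the exponents add up to 1.
\<close>

lemma weighted_geometric_mean_le_add:
  fixes x y \<theta> :: real
  assumes "x \<ge> 0" "y \<ge> 0" "0 \<le> \<theta>" "\<theta> \<le> 1"
  shows "x powr \<theta> * y powr (1 - \<theta>) \<le> x + y"
proof -
  have "x powr \<theta> * y powr (1 - \<theta>) \<le> (x + y) powr \<theta> * (x + y) powr (1 - \<theta>)"
    using assms by (intro mult_mono powr_mono2) auto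
  also have "\<dots> = x + y"
    using assms by (simp flip: powr_add)
  finally show ?thesis .
qed

text \<open>
  In \<open>c\<^sup>r = (w c)\<^sup>r w\<^bsup>-r\<^esup> \<le> (w c)\<^sup>r g\<^sup>r\<close> the exponent of \<open>g\<close> is split as \<open>r = q (1 - r/2) + q r s\<close>, which is the
  definition of \<open>s\<close> multiplied by \<open>q r\<close>. The first part forms a weighted geometric mean with
  \<open>(w c)\<^sup>2\<close>; the second has a nonnegative exponent because \<open>s > 0\<close>, so the bound \<open>b\<close> applies to it.
\<close>

lemma powr_le_of_weighted_square:
  fixes c w g q r s b :: real
  assumes "c > 0" "w > 0" "inverse w \<le> g" "q > 0" "0 < r" "r \<le> 2" "s > 0"
    and s: "s = 1 / q + 1 / 2 - 1 / r" and b: "g powr q \<le> b"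
  shows "c powr r \<le> b powr (r * s) * ((w * c)\<^sup>2 + g powr q)"
proof -
  have g: "g > 0"
    using assms(2,3) by (meson inverse_positive_iff_positive less_le_trans)
  have exps: "r = q * (1 - r / 2) + q * (r * s)"
    using \<open>q > 0\<close> \<open>0 < r\<close> unfolding s by (simp add: field_simps)
  have "c powr r = (w * c) powr r * inverse w powr r"
    using assms(1,2) by (simp add: field_simps flip: powr_mult)
  also have "\<dots> \<le> (w * c) powr r * g powr r"
    using assms by (intro mult_left_mono powr_mono2) auto
  also have "(w * c) powr r = ((w * c)\<^sup>2) powr (r / 2)"
    using assms(1,2) by (simp add: powr_powr flip: powr_numeral)
  also have "g powr r = (g powr q) powr (1 - r / 2) * (g powr q) powr (r * s)"
    using exps by (simp add: powr_powr flip: powr_add)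
  also have "((w * c)\<^sup>2) powr (r / 2) * ((g powr q) powr (1 - r / 2) * (g powr q) powr (r * s))
      = (g powr q) powr (r * s) * (((w * c)\<^sup>2) powr (r / 2) * (g powr q) powr (1 - r / 2))"
    by (simp only: mult_ac)
  also have "\<dots> \<le> b powr (r * s) * ((w * c)\<^sup>2 + g powr q)"
    using assms by (intro mult_mono powr_mono2 weighted_geometric_mean_le_add) auto
  finally show ?thesis .
qed

section \<open>Monotone majorants\<close>

lemma abs_le_monotone_majorant:
  assumes "bounded (\<kappa> ` F)" "x \<in> F" "y \<in> F" "x \<le> y"
  shows "\<bar>\<kappa> y\<bar> \<le> monotone_majorant F \<kappa> x"
  unfolding monotone_majorant_def
proof (rule cSUP_upper)
  obtain B where "\<And>z. z \<in> F \<Longrightarrow> \<bar>\<kappa> z\<bar> \<le> B"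
    using assms(1) by (auto simp: bounded_iff)
  then show "bdd_above ((\<lambda>z. \<bar>\<kappa> z\<bar>) ` {z \<in> F. x \<le> z})"
    by (auto intro!: bdd_aboveI2)
qed (use assms in auto)

lemma monotone_majorant_antimono:
  assumes "bounded (\<kappa> ` F)" "x \<in> F" "y \<in> F" "x \<le> y"
  shows "monotone_majorant F \<kappa> y \<le> monotone_majorant F \<kappa> x"
proof -
  have "(SUP z\<in>{z \<in> F. y \<le> z}. \<bar>\<kappa> z\<bar>) \<le> monotone_majorant F \<kappa> x"
    using assms by (intro cSUP_least) (auto intro: abs_le_monotone_majorant order_trans)
  then show ?thesis
    by (simp add: monotone_majorant_def)
qed

section \<open>Decay of tails outside nested downward closed sets\<close>

theorem theorem2p3:
  fixes d :: enat
    and F :: "(nat \<Rightarrow> nat) set"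
    and c \<omega> \<kappa> :: "(nat \<Rightarrow> nat) \<Rightarrow> real"
    and q r s :: real
  assumes "d \<ge> 1"
    and "F = multi_indices d"
    and "\<And>\<nu>. \<nu> \<in> F \<Longrightarrow> c \<nu> > 0"
    and "\<And>\<nu>. \<nu> \<in> F \<Longrightarrow> \<omega> \<nu> > 0"
    and "(\<lambda>\<nu>. (\<omega> \<nu> * c \<nu>)\<^sup>2) summable_on F"
    and "\<And>\<nu>. \<nu> \<in> F \<Longrightarrow> \<kappa> \<nu> = inverse (\<omega> \<nu>)"
    and "0 < q"
    and "\<kappa> \<in> ell_m q F"
    and "0 < r" and "r \<le> 2"
    and "1 / q > 1 / r - 1 / 2"
    and "s = 1 / q + 1 / 2 - 1 / r"
  shows "s > 0 \<and>
    (\<exists>(C::real) (\<Lambda> :: nat \<Rightarrow> (nat \<Rightarrow> nat) set).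
      (\<forall>n\<ge>1. \<Lambda> n \<subseteq> \<Lambda> (Suc n)) \<and>
      (\<forall>n\<ge>1. downward_closed F (\<Lambda> n)) \<and>
      (\<forall>n\<ge>1. card (\<Lambda> n) = n \<and>
         (\<lambda>\<nu>. c \<nu> powr r) summable_on (F - \<Lambda> n) \<and>
         (\<Sum>\<^sub>\<infinity>\<nu>\<in>F - \<Lambda> n. c \<nu> powr r) powr (1 / r) \<le> C * real n powr (- s)))"
proof -
  note F = assms(2) and cpos = assms(3) and wpos = assms(4) and xsum = assms(5) and kap = assms(6)
    and q = assms(7) and r = assms(9) and s = assms(12)
  have spos: "s > 0"
    using assms(11) s by simp
  define g where "g = monotone_majorant F \<kappa>"
  have bdd: "bounded (\<kappa> ` F)"
    using assms(8) by (simp add: ell_m_def)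
  have kap_le: "inverse (\<omega> \<nu>) \<le> g \<nu>" if "\<nu> \<in> F" for \<nu>
    using abs_le_monotone_majorant[OF bdd that that] kap[OF that] wpos[OF that] by (simp add: g_def)
  have gpos: "g \<nu> > 0" if "\<nu> \<in> F" for \<nu>
    using kap_le[OF that] wpos[OF that] by (meson inverse_positive_iff_positive less_le_trans)
  have gsum: "(\<lambda>\<nu>. g \<nu> powr q) summable_on F"
  proof -
    have "(\<lambda>\<nu>. \<bar>g \<nu>\<bar> powr q) summable_on F"
      using assms(8) by (simp add: ell_m_def ell_def g_def)
    moreover have "\<bar>g \<nu>\<bar> = g \<nu>" if "\<nu> \<in> F" for \<nu>
      using gpos[OF that] by simp
    ultimately show ?thesis
      by (simp cong: summable_on_cong)
  qed
  obtain \<Lambda> :: "nat \<Rightarrow> (nat \<Rightarrow> nat) set" where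
    fin: "\<And>n. finite (\<Lambda> n)" and card: "\<And>n. card (\<Lambda> n) = n" and nested: "\<And>n. \<Lambda> n \<subseteq> \<Lambda> (Suc n)"
    and dc: "\<And>n. downward_closed F (\<Lambda> n)"
    and greedy: "\<And>n \<mu> \<nu>. \<mu> \<in> \<Lambda> n \<Longrightarrow> \<nu> \<in> F - \<Lambda> n \<Longrightarrow> g \<nu> \<le> g \<mu>"
  proof (rule greedy_downward_closed_sets[of F g])
    show "infinite F"
      using infinite_multi_indices assms(1) F by simp
    show "g y \<le> g x" if "x \<in> F" "y \<in> F" "x \<le> y" for x y
      using monotone_majorant_antimono[OF bdd that] by (simp add: g_def)
    show "finite {x \<in> F. g x \<ge> \<delta>}" if "\<delta> > 0" for \<delta>
      using finite_superlevel_set_if_summable_powr gsum q that by blast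
  qed (use gpos in blast)+
  define X where "X = (\<Sum>\<^sub>\<infinity>\<nu>\<in>F. (\<omega> \<nu> * c \<nu>)\<^sup>2)"
  define G where "G = (\<Sum>\<^sub>\<infinity>\<nu>\<in>F. g \<nu> powr q)"
  have XG: "X \<ge> 0" "G \<ge> 0"
    by (auto simp: X_def G_def intro!: infsum_nonneg)
  define C where "C = G powr s * (X + G) powr (1 / r)"
  have tail: "(\<lambda>\<nu>. c \<nu> powr r) summable_on (F - \<Lambda> n) \<and>
      (\<Sum>\<^sub>\<infinity>\<nu>\<in>F - \<Lambda> n. c \<nu> powr r) powr (1 / r) \<le> C * real n powr (- s)"
    if n: "n \<ge> 1" for n
  proof -
    let ?T = "F - \<Lambda> n"
    let ?b = "G / real n"
    let ?h = "\<lambda>\<nu>. (\<omega> \<nu> * c \<nu>)\<^sup>2 + g \<nu> powr q"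
    have \<Lambda>F: "\<Lambda> n \<subseteq> F"
      using dc[of n] by (simp add: downward_closed_def)
    have gb: "g \<nu> powr q \<le> ?b" if \<nu>: "\<nu> \<in> ?T" for \<nu>
    proof -
      have "g \<nu> powr q \<le> g \<mu> powr q" if "\<mu> \<in> \<Lambda> n" for \<mu>
        using greedy[OF that \<nu>] gpos[of \<nu>] \<nu> q by (intro powr_mono2) auto
      then have "real (card (\<Lambda> n)) * g \<nu> powr q \<le> G"
        unfolding G_def using gsum fin \<Lambda>F by (intro card_mult_le_infsum) auto
      then show ?thesis
        using n card by (simp add: field_simps)
    qed
    have pointwise: "c \<nu> powr r \<le> ?b powr (r * s) * ?h \<nu>" if "\<nu> \<in> ?T" for \<nu>
      using that cpos wpos kap_le q r assms(10) spos s gb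
      by (intro powr_le_of_weighted_square) auto
    have hF: "?h summable_on F"
      by (intro summable_on_add xsum gsum)
    have hT: "?h summable_on ?T"
      using hF by (rule summable_on_subset_banach) auto
    have "infsum ?h ?T \<le> infsum ?h F"
      using hT hF by (intro infsum_mono_neutral) auto
    also have "\<dots> = X + G"
      unfolding X_def G_def by (intro infsum_add xsum gsum)
    finally have hle: "infsum ?h ?T \<le> X + G" .
    have bh: "(\<lambda>\<nu>. ?b powr (r * s) * ?h \<nu>) summable_on ?T"
      using hT by (rule summable_on_cmult_right)
    have sm: "(\<lambda>\<nu>. c \<nu> powr r) summable_on ?T"
      by (rule summable_on_comparison_test[OF bh]) (use pointwise in auto)
    have "(\<Sum>\<^sub>\<infinity>\<nu>\<in>?T. c \<nu> powr r) \<le> (\<Sum>\<^sub>\<infinity>\<nu>\<in>?T. ?b powr (r * s) * ?h \<nu>)"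
      using sm bh pointwise by (rule infsum_mono)
    also have "\<dots> = ?b powr (r * s) * infsum ?h ?T"
      by (rule infsum_cmult_right) (use hT in blast)
    also have "\<dots> \<le> ?b powr (r * s) * (X + G)"
      using hle by (rule mult_left_mono) simp
    finally have "(\<Sum>\<^sub>\<infinity>\<nu>\<in>?T. c \<nu> powr r) powr (1 / r) \<le> (?b powr (r * s) * (X + G)) powr (1 / r)"
      using r by (intro powr_mono2 infsum_nonneg) auto
    also have "\<dots> = ?b powr s * (X + G) powr (1 / r)"
      using r XG by (simp add: powr_mult powr_powr)
    also have "\<dots> = C * real n powr (- s)"
      using XG n by (simp add: C_def powr_divide powr_minus_divide)
    finally show ?thesis
      using sm by blast
  qed
  show ?thesis
    using spos nested dc card tail by blast
qed

end
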